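(* Let $(X,d_X)$ be a hereditarily Baire metric space and $(Y,d_Y)$ be a metric space. For a map $f:X\to Y$ the following conditions are equivalent: (1) $f$ is a $\sigma$-discrete map with a ($\sigma$-discrete) base which consists of $F_\sigma$-subsets of $X$; (2) $f$ belongs to the first Lebesgue class, i.e. the set $f^{-1}(V)$ is $F_\sigma$ in $X$ for any open set $V\subseteq Y$; (3) $f$ is barely continuous, i.e. for each non-empty closed subset $F\subseteq X$ the restriction $f|_F$ has a continuity point; (4) for any $\varepsilon>0$ there exists a Baire-one function $\delta:X\to\mathbb R^+$ such that for all $x,y\in X$ $$d_X(x,y)<\min\{\delta(x),\delta(y)\}\ \Longrightarrow\ d_Y(f(x),f(y))<\varepsilon;$$ (5) for any $\varepsilon>0$ there exists a function $\delta:X\to\mathbb R^+$ such that the implication displayed in (4) holds for all $x,y\in X$.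
   Context: $\mathbb R^+=(0,+\infty)$. A space is hereditarily Baire if each of its closed subspaces is a Baire space. A Baire-one function $\delta:X\to\mathbb R^+$ is a pointwise limit of a sequence of continuous functions $X\to\mathbb R^+$. A family of subsets of $X$ is discrete if every point of $X$ has an open neighborhood which intersects at most one set of the family; it is $\sigma$-discrete if it is a countable union of discrete families. A family $\mathcal B$ of subsets of $X$ is a base for a map $f:X\to Y$ if for every open $V\subseteq Y$ the set $f^{-1}(V)$ is a union of sets from $\mathcal B$. The map $f$ is $\sigma$-discrete if it has a $\sigma$-discrete base; condition (1) says that $f$ has a $\sigma$-discrete base all of whose members are $F_\sigma$-sets in $X$. *)

theory Defs
  imports "HOL-Analysis.Analysis"
begin

definition Baire_space :: "'a topology \<Rightarrow> bool"
  where "Baire_space X \<longleftrightarrow>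
    (\<forall>U :: nat \<Rightarrow> 'a set.
      (\<forall>n. openin X (U n) \<and> X closure_of U n = topspace X) \<longrightarrow>
      X closure_of (\<Inter>n. U n) = topspace X)"

definition hereditarily_Baire :: "'a topology \<Rightarrow> bool"
  where "hereditarily_Baire X \<longleftrightarrow>
    (\<forall>F. closedin X F \<longrightarrow> Baire_space (subtopology X F))"

definition Baire_one_pos :: "('a::topological_space \<Rightarrow> real) \<Rightarrow> bool"
  where "Baire_one_pos \<delta> \<longleftrightarrow> (\<forall>x. \<delta> x > 0) \<and>
    (\<exists>g :: nat \<Rightarrow> 'a \<Rightarrow> real.
      (\<forall>n. continuous_on UNIV (g n) \<and> (\<forall>x. g n x > 0)) \<and>
      (\<forall>x. (\<lambda>n. g n x) \<longlonglongrightarrow> \<delta> x))"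

definition discrete_family :: "'a::topological_space set set \<Rightarrow> bool"
  where "discrete_family \<A> \<longleftrightarrow>
    (\<forall>x. \<exists>U. open U \<and> x \<in> U \<and>
      (\<forall>A\<in>\<A>. \<forall>B\<in>\<A>. A \<inter> U \<noteq> {} \<and> B \<inter> U \<noteq> {} \<longrightarrow> A = B))"

definition sigma_discrete_family :: "'a::topological_space set set \<Rightarrow> bool"
  where "sigma_discrete_family \<B> \<longleftrightarrow>
    (\<exists>\<A> :: nat \<Rightarrow> 'a set set. (\<forall>n. discrete_family (\<A> n)) \<and> \<B> = (\<Union>n. \<A> n))"

definition base_for_map :: "('a \<Rightarrow> 'b::topological_space) \<Rightarrow> 'a set set \<Rightarrow> bool"
  where "base_for_map f \<B> \<longleftrightarrow> (\<forall>V. open V \<longrightarrow> (\<exists>\<U>\<subseteq>\<B>. f -` V = \<Union>\<U>))"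

definition sigma_discrete_map_fsigma_base ::
    "('a::topological_space \<Rightarrow> 'b::topological_space) \<Rightarrow> bool"
  where "sigma_discrete_map_fsigma_base f \<longleftrightarrow>
    (\<exists>\<B>. sigma_discrete_family \<B> \<and> base_for_map f \<B> \<and> (\<forall>B\<in>\<B>. fsigma B))"

definition first_Lebesgue_class ::
    "('a::topological_space \<Rightarrow> 'b::topological_space) \<Rightarrow> bool"
  where "first_Lebesgue_class f \<longleftrightarrow> (\<forall>V. open V \<longrightarrow> fsigma (f -` V))"

text \<open>Continuity of the restriction of \<open>f\<close> to \<open>F\<close> at a point is taken with respect to the
  subspace topology, so the filter is \<open>at x within F\<close>; isolated points of \<open>F\<close> count as
  continuity points.\<close>

definition barely_continuous ::
    "('a::t2_space \<Rightarrow> 'b::topological_space) \<Rightarrow> bool"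
  where "barely_continuous f \<longleftrightarrow>
    (\<forall>F. closed F \<and> F \<noteq> {} \<longrightarrow> (\<exists>x\<in>F. continuous (at x within F) f))"

definition gauge_condition ::
    "('a::metric_space \<Rightarrow> 'b::metric_space) \<Rightarrow> real \<Rightarrow> ('a \<Rightarrow> real) \<Rightarrow> bool"
  where "gauge_condition f \<epsilon> \<delta> \<longleftrightarrow>
    (\<forall>x y. dist x y < min (\<delta> x) (\<delta> y) \<longrightarrow> dist (f x) (f y) < \<epsilon>)"

end

theory Submission
  imports Defs
begin

text \<open>All conditions are compared with fragmentation: for every \<open>\<epsilon> > 0\<close>, every nonempty closed set
  has a nonempty relatively open subset on which \<open>f\<close> oscillates by less than \<open>\<epsilon>\<close>. Baire category
  derives it from a gauge and, after a reduction to separable closed subspaces, from the first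
  Lebesgue class, and it turns fragmentation back into continuity points. Conversely, peeling off
  such relatively open pieces transfinitely splits the space into differences of open sets on which
  \<open>f\<close> oscillates little; since they come from a well-ordered open cover, each is an increasing
  union of closed parts such that, at every stage \<open>n\<close>, the parts of different pieces are at distance
  at least \<open>1/(n+1)\<close>. These parts form the base, and the first stage at which a point appears
  gives the gauge.\<close>

text \<open>Testing closed sets suffices: an open set that meets the closure of a set also meets the
  set itself. The scale stays a parameter because the decomposition and the gauge are both built for
  one \<open>\<epsilon>\<close> at a time.\<close>

definition fragmented :: "('a::metric_space \<Rightarrow> 'b::metric_space) \<Rightarrow> real \<Rightarrow> bool"
  where "fragmented f \<epsilon> \<longleftrightarrow>
    (\<forall>F. closed F \<and> F \<noteq> {} \<longrightarrow>
      (\<exists>W. open W \<and> W \<inter> F \<noteq> {} \<and> (\<forall>x\<in>W \<inter> F. \<forall>y\<in>W \<inter> F. dist (f x) (f y) < \<epsilon>)))"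

lemma fragmentedD:
  assumes "fragmented f \<epsilon>" "closed F" "F \<noteq> {}"
  obtains W where "open W" "W \<inter> F \<noteq> {}" "\<forall>x\<in>W \<inter> F. \<forall>y\<in>W \<inter> F. dist (f x) (f y) < \<epsilon>"
  using assms(1)[unfolded fragmented_def, THEN spec, of F] assms(2,3) that by blast

subsection \<open>Baire category\<close>

text \<open>If no \<open>C n\<close> had relative interior in \<open>F\<close>, the sets
  \<open>F - C n\<close> would be relatively open and dense in the Baire space \<open>F\<close>,
  while the covering makes their intersection empty.\<close>

lemma hereditarily_Baire_closed_cover:
  fixes F :: "'a::metric_space set" and C :: "nat \<Rightarrow> 'a set"
  assumes hB: "hereditarily_Baire (euclidean :: 'a topology)"
    and F: "closed F" "F \<noteq> {}" and C: "\<And>n. closed (C n)" and cov: "F \<subseteq> (\<Union>n. C n)"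
  obtains n W where "open W" "W \<inter> F \<noteq> {}" "W \<inter> F \<subseteq> C n"
proof (rule ccontr)
  assume "\<not> thesis"
  then have no: "\<not> W \<inter> F \<subseteq> C n" if "open W" "W \<inter> F \<noteq> {}" for W n
    using that \<open>\<And>W n. open W \<Longrightarrow> W \<inter> F \<noteq> {} \<Longrightarrow> W \<inter> F \<subseteq> C n \<Longrightarrow> thesis\<close> by blast
  let ?X = "subtopology (euclidean :: 'a topology) F"
  have Baire: "Baire_space ?X"
    using hB F unfolding hereditarily_Baire_def by simp
  have "openin ?X (F - C n) \<and> ?X closure_of (F - C n) = topspace ?X" for n
  proof
    have "F - C n = F \<inter> - C n" by blast
    then show "openin ?X (F - C n)"
      using C[of n] by (metis openin_open_Int open_Compl)
    have "F \<subseteq> closure (F - C n)"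
    proof
      fix x assume "x \<in> F"
      have "\<exists>y \<in> F - C n. y \<in> W" if "open W" "x \<in> W" for W
        using no[OF that(1), of n] that(2) \<open>x \<in> F\<close> by blast
      then show "x \<in> closure (F - C n)"
        by (meson closure_iff_nhds_not_empty disjoint_iff subsetD)
    qed
    then show "?X closure_of (F - C n) = topspace ?X"
      by (auto simp: closure_of_subtopology Int_absorb1 Diff_subset)
  qed
  then have "?X closure_of (\<Inter>n. F - C n) = topspace ?X"
    using Baire[unfolded Baire_space_def, THEN spec, of "\<lambda>n. F - C n"] by blast
  moreover have "(\<Inter>n. F - C n) = {}"
    using cov by blast
  ultimately show False
    using F(2) by (metis closure_of_empty topspace_euclidean_subtopology)
qed

lemma hereditarily_Baire_fsigma_cover:
  fixes F :: "'a::metric_space set"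
  assumes hB: "hereditarily_Baire (euclidean :: 'a topology)"
    and F: "closed F" "F \<noteq> {}" and S: "countable \<S>" "\<And>S. S \<in> \<S> \<Longrightarrow> fsigma S" and cov: "F \<subseteq> \<Union>\<S>"
  obtains S W where "S \<in> \<S>" "open W" "W \<inter> F \<noteq> {}" "W \<inter> F \<subseteq> S"
proof -
  have "\<exists>C :: nat \<Rightarrow> 'a set. (\<forall>n. closed (C n)) \<and> S = (\<Union>n. C n)" if "S \<in> \<S>" for S
    using S(2)[OF that] by (cases rule: fsigma.cases) auto
  then obtain C :: "'a set \<Rightarrow> nat \<Rightarrow> 'a set"
    where C: "\<And>S n. S \<in> \<S> \<Longrightarrow> closed (C S n)" "\<And>S. S \<in> \<S> \<Longrightarrow> S = (\<Union>n. C S n)"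
    by metis
  have ne: "\<S> \<noteq> {}"
    using cov F(2) by blast
  define D where "D k = (case prod_decode k of (m, n) \<Rightarrow> C (from_nat_into \<S> m) n)" for k
  have in_S: "from_nat_into \<S> m \<in> \<S>" for m
    by (simp add: from_nat_into ne)
  have D: "closed (D k)" for k
    unfolding D_def using C(1)[OF in_S] by (auto split: prod.split)
  have "F \<subseteq> (\<Union>k. D k)"
  proof
    fix x assume "x \<in> F"
    then obtain S where "S \<in> \<S>" "x \<in> S" using cov by blast
    moreover obtain m where "from_nat_into \<S> m = S"
      using \<open>S \<in> \<S>\<close> S(1) by (meson from_nat_into_surj)
    ultimately obtain n where "x \<in> C (from_nat_into \<S> m) n"
      using C(2) by blast
    then have "x \<in> D (prod_encode (m, n))" by (simp add: D_def)
    then show "x \<in> (\<Union>k. D k)" by blast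
  qed
  then obtain k W where W: "open W" "W \<inter> F \<noteq> {}" "W \<inter> F \<subseteq> D k"
    using hereditarily_Baire_closed_cover[of F D] hB F D by metis
  obtain m n where "prod_decode k = (m, n)" by fastforce
  then have "D k \<subseteq> from_nat_into \<S> m"
    using C(2)[OF in_S[of m]] by (auto simp: D_def)
  then show thesis
    using that[OF in_S W(1,2)] W(3) by blast
qed

subsection \<open>Fragmented maps and continuity points\<close>

lemma barely_continuous_imp_fragmented:
  fixes f :: "'a::metric_space \<Rightarrow> 'b::metric_space"
  assumes "barely_continuous f" "\<epsilon> > 0"
  shows "fragmented f \<epsilon>"
  unfolding fragmented_def
proof (intro allI impI)
  fix F :: "'a set" assume "closed F \<and> F \<noteq> {}"
  then obtain x where x: "x \<in> F" "continuous (at x within F) f"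
    using assms(1) unfolding barely_continuous_def by blast
  then obtain d where d: "d > 0" "\<And>y. y \<in> F \<Longrightarrow> dist y x < d \<Longrightarrow> dist (f y) (f x) < \<epsilon>/2"
    using \<open>\<epsilon> > 0\<close> unfolding continuous_within_eps_delta by (meson half_gt_zero)
  have "dist (f y) (f z) < \<epsilon>" if "y \<in> ball x d \<inter> F" "z \<in> ball x d \<inter> F" for y z
    using that d(2)[of y] d(2)[of z] dist_triangle_half_l[of "f y" "f x" \<epsilon> "f z"]
    by (simp add: dist_commute)
  moreover have "ball x d \<inter> F \<noteq> {}"
    using x(1) d(1) by (metis IntI centre_in_ball empty_iff)
  ultimately show "\<exists>W. open W \<and> W \<inter> F \<noteq> {} \<and> (\<forall>x\<in>W \<inter> F. \<forall>y\<in>W \<inter> F. dist (f x) (f y) < \<epsilon>)"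
    by (intro exI[of _ "ball x d"]) auto
qed

text \<open>A point of \<open>F\<close> is a continuity point once, for every \<open>n\<close>, it
  has a neighbourhood in \<open>F\<close> on which \<open>f\<close> oscillates by less than
  \<open>1/(n+1)\<close>. Fragmentation makes the set of such points dense in \<open>F\<close> for
  each \<open>n\<close>, and Baire category yields a common point.\<close>

lemma fragmented_imp_barely_continuous:
  fixes f :: "'a::metric_space \<Rightarrow> 'b::metric_space"
  assumes hB: "hereditarily_Baire (euclidean :: 'a topology)"
    and frag: "\<And>\<epsilon>. \<epsilon> > 0 \<Longrightarrow> fragmented f \<epsilon>"
  shows "barely_continuous f"
  unfolding barely_continuous_def
proof (intro allI impI)
  fix F :: "'a set" assume F: "closed F \<and> F \<noteq> {}"
  define \<W> where "\<W> n = {W. open W \<and> (\<forall>x\<in>W \<inter> F. \<forall>y\<in>W \<inter> F. dist (f x) (f y) < inverse (Suc n))}" for n :: nat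
  have "\<exists>x\<in>F. \<forall>n. x \<in> \<Union>(\<W> n)"
  proof (rule ccontr)
    assume "\<not> ?thesis"
    then have "F \<subseteq> (\<Union>n. - \<Union>(\<W> n))" by blast
    moreover have "closed (- \<Union>(\<W> n))" for n
      by (auto simp: \<W>_def intro!: closed_Compl open_Union)
    ultimately obtain n V where V: "open V" "V \<inter> F \<noteq> {}" "V \<inter> F \<subseteq> - \<Union>(\<W> n)"
      using hereditarily_Baire_closed_cover[of F "\<lambda>n. - \<Union>(\<W> n)"] hB F by metis
    \<comment> \<open>\<open>V \<inter> F\<close> need not be closed, so fragmentation is applied to
      its closure; the open set obtained there still meets \<open>V \<inter> F\<close>.\<close>
    have ne: "closure (V \<inter> F) \<noteq> {}" using V(2) by auto
    have "fragmented f (inverse (Suc n))" by (intro frag) simp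
    then obtain W where W: "open W" "W \<inter> closure (V \<inter> F) \<noteq> {}"
        "\<forall>x\<in>W \<inter> closure (V \<inter> F). \<forall>y\<in>W \<inter> closure (V \<inter> F). dist (f x) (f y) < inverse (Suc n)"
      by (rule fragmentedD[OF _ closed_closure ne])
    have "W \<inter> (V \<inter> F) \<noteq> {}"
      using W(1,2) open_Int_closure_eq_empty by blast
    moreover have "W \<inter> V \<in> \<W> n"
      unfolding \<W>_def using W(1,3) V(1) closure_subset[of "V \<inter> F"] by (simp add: open_Int subset_iff)
    ultimately show False using V(3) by blast
  qed
  then obtain x where x: "x \<in> F" "\<And>n. x \<in> \<Union>(\<W> n)" by blast
  have "\<exists>d>0. \<forall>y\<in>F. dist y x < d \<longrightarrow> dist (f y) (f x) < e" if "e > 0" for e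
  proof -
    obtain n where n: "inverse (Suc n) < e"
      using reals_Archimedean[OF \<open>e > 0\<close>] by blast
    obtain W where W: "W \<in> \<W> n" "x \<in> W" using x(2)[of n] by blast
    then obtain d where "d > 0" "ball x d \<subseteq> W"
      unfolding \<W>_def by (metis (no_types, lifting) mem_Collect_eq open_contains_ball)
    moreover have "dist (f y) (f x) < e" if "y \<in> F" "y \<in> W" for y
      using W n x(1) that unfolding \<W>_def by (auto intro: less_trans)
    ultimately show ?thesis
      by (metis dist_commute mem_ball subsetD)
  qed
  then have "continuous (at x within F) f"
    unfolding continuous_within_eps_delta by blast
  with x(1) show "\<exists>x\<in>F. continuous (at x within F) f" by blast
qed

subsection \<open>Sufficient conditions for fragmentation\<close>

text \<open>By category, the points whose gauge exceeds some fixed \<open>r\<close> are dense in a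
  relatively open part of \<open>F\<close>. Two nearby points there are compared through two such
  points, and each of the three links costs less than \<open>\<epsilon>/3\<close>.\<close>

lemma gauge_condition_imp_fragmented:
  fixes f :: "'a::metric_space \<Rightarrow> 'b::metric_space"
  assumes hB: "hereditarily_Baire (euclidean :: 'a topology)"
    and pos: "\<And>x. \<delta> x > 0" and gauge: "gauge_condition f (\<epsilon>/3) \<delta>"
  shows "fragmented f \<epsilon>"
  unfolding fragmented_def
proof (intro allI impI)
  fix F :: "'a set" assume F: "closed F \<and> F \<noteq> {}"
  define A where "A n = {x \<in> F. \<delta> x > inverse (Suc n)}" for n :: nat
  have "F \<subseteq> (\<Union>n. closure (A n))"
  proof
    fix x assume "x \<in> F"
    moreover obtain n where "inverse (Suc n) < \<delta> x"
      using reals_Archimedean[OF pos] by blast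
    ultimately have "x \<in> A n" by (simp add: A_def)
    then show "x \<in> (\<Union>n. closure (A n))" using closure_subset by blast
  qed
  then obtain n V where V: "open V" "V \<inter> F \<noteq> {}" "V \<inter> F \<subseteq> closure (A n)"
    using hereditarily_Baire_closed_cover[of F "\<lambda>n. closure (A n)"] hB F by (metis closed_closure)
  define r where "r = inverse (Suc n)"
  have "r > 0" by (simp add: r_def)
  have approx: "\<exists>a\<in>A n. dist a x < r/4 \<and> dist (f a) (f x) < \<epsilon>/3" if "x \<in> V \<inter> F" for x
  proof -
    \<comment> \<open>The gauge at \<open>x\<close> may be far smaller than \<open>r\<close>, so the
      approximating point is chosen after \<open>x\<close> and within \<open>\<delta> x\<close>; its
      own gauge exceeds \<open>r\<close> anyway.\<close>
    have "min (\<delta> x) (r/4) > 0" using pos[of x] \<open>r > 0\<close> by simp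
    moreover have "x \<in> closure (A n)" using V(3) that by blast
    ultimately obtain a where a: "a \<in> A n" "dist a x < min (\<delta> x) (r/4)"
      using closure_approachable[of x "A n"] by blast
    moreover have "r < \<delta> a" using a(1) by (simp add: A_def r_def)
    ultimately have "dist a x < min (\<delta> a) (\<delta> x)"
      using \<open>r > 0\<close> by auto
    then show ?thesis
      using gauge a unfolding gauge_condition_def by (intro bexI[of _ a]) auto
  qed
  obtain w where w: "w \<in> V" "w \<in> F" using V(2) by blast
  \<comment> \<open>The path from \<open>a\<close> to \<open>b\<close> through \<open>x\<close>,
    \<open>w\<close>, \<open>y\<close> has four legs, each shorter than \<open>r/4\<close>.\<close>
  let ?W = "V \<inter> ball w (r/4)"
  have "dist (f x) (f y) < \<epsilon>" if "x \<in> ?W \<inter> F" "y \<in> ?W \<inter> F" for x y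
  proof -
    obtain a where a: "a \<in> A n" "dist a x < r/4" "dist (f a) (f x) < \<epsilon>/3"
      using approx[of x] \<open>x \<in> ?W \<inter> F\<close> by blast
    obtain b where b: "b \<in> A n" "dist b y < r/4" "dist (f b) (f y) < \<epsilon>/3"
      using approx[of y] \<open>y \<in> ?W \<inter> F\<close> by blast
    have "dist w x < r/4" "dist w y < r/4" using that by auto
    then have "dist a b < r"
      using a(2) b(2) dist_triangle[of a b x] dist_triangle[of x b w] dist_triangle[of w b y]
      by (simp add: dist_commute)
    then have "dist (f a) (f b) < \<epsilon>/3"
      using gauge a(1) b(1) unfolding gauge_condition_def A_def r_def by auto
    then show ?thesis
      using a(3) b(3) dist_triangle[of "f x" "f y" "f a"] dist_triangle[of "f a" "f y" "f b"]
      by (simp add: dist_commute)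
  qed
  moreover have "?W \<inter> F \<noteq> {}" using w \<open>r > 0\<close> by auto
  ultimately show "\<exists>W. open W \<and> W \<inter> F \<noteq> {} \<and> (\<forall>x\<in>W \<inter> F. \<forall>y\<in>W \<inter> F. dist (f x) (f y) < \<epsilon>)"
    using V(1) by (intro exI[of _ ?W]) auto
qed

text \<open>The orbit of \<open>x0\<close> is indexed by finite words over the naturals, hence
  countable; appending a letter applies \<open>s\<close> once more.\<close>

lemma ex_countable_closed_under:
  fixes s :: "'a \<Rightarrow> nat \<Rightarrow> 'a"
  assumes "x0 \<in> F" "\<And>x n. x \<in> F \<Longrightarrow> s x n \<in> F"
  obtains Q where "countable Q" "x0 \<in> Q" "Q \<subseteq> F" "\<And>x n. x \<in> Q \<Longrightarrow> s x n \<in> Q"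
proof
  let ?Q = "range (foldl s x0)"
  show "countable ?Q" by blast
  show "x0 \<in> ?Q" by (metis foldl_Nil rangeI)
  have "foldl s x0 ns \<in> F" for ns
    by (induction ns rule: rev_induct) (auto simp: assms)
  then show "?Q \<subseteq> F" by blast
  show "s x n \<in> ?Q" if "x \<in> ?Q" for x n
  proof -
    from \<open>x \<in> ?Q\<close> obtain ns where "x = foldl s x0 ns" by blast
    then have "s x n = foldl s x0 (ns @ [n])" by simp
    then show ?thesis by blast
  qed
qed

text \<open>The reduction to the separable case, which makes the argument work for nonseparable \<open>Y\<close>: if
  \<open>f\<close> oscillates everywhere on \<open>F\<close>, then it already oscillates everywhere on a countable set
  \<open>Q \<subseteq> F\<close>. The closure of \<open>Q\<close> is covered by the preimages of the complement of the closure of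
  \<open>f(Q)\<close> and of small balls around the points of \<open>f(Q)\<close>, and neither kind can contain a nonempty
  relatively open set.\<close>

lemma first_Lebesgue_class_imp_fragmented:
  fixes f :: "'a::metric_space \<Rightarrow> 'b::metric_space"
  assumes hB: "hereditarily_Baire (euclidean :: 'a topology)"
    and f: "first_Lebesgue_class f" and "\<epsilon> > 0"
  shows "fragmented f \<epsilon>"
proof (rule ccontr)
  assume "\<not> fragmented f \<epsilon>"
  then obtain F where F: "closed F" "F \<noteq> {}"
    and osc: "\<And>W. open W \<Longrightarrow> W \<inter> F \<noteq> {} \<Longrightarrow> \<exists>x\<in>W \<inter> F. \<exists>y\<in>W \<inter> F. \<epsilon> \<le> dist (f x) (f y)"
    unfolding fragmented_def by (meson not_less)
  \<comment> \<open>Oscillation between two unspecified points becomes oscillation at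
    \<open>x\<close>: one of the two images is at least \<open>\<epsilon>/2\<close> from
    \<open>f x\<close>. A set closed under \<open>s\<close> therefore inherits the oscillation at
    each of its points.\<close>
  have "\<exists>y\<in>F. dist y x < inverse (Suc n) \<and> \<epsilon>/2 \<le> dist (f x) (f y)" if "x \<in> F" for x and n :: nat
  proof -
    have "x \<in> ball x (inverse (Suc n)) \<inter> F" using that by simp
    then obtain y z where yz: "y \<in> ball x (inverse (Suc n)) \<inter> F" "z \<in> ball x (inverse (Suc n)) \<inter> F"
        "\<epsilon> \<le> dist (f y) (f z)"
      using osc[of "ball x (inverse (Suc n))"] by blast
    then have "\<epsilon>/2 \<le> dist (f x) (f y) \<or> \<epsilon>/2 \<le> dist (f x) (f z)"
      using dist_triangle[of "f y" "f z" "f x"] by (simp add: dist_commute) linarith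
    then show ?thesis using yz by (auto simp: dist_commute)
  qed
  then obtain s where s: "\<And>x n. x \<in> F \<Longrightarrow> s x n \<in> F"
      "\<And>x n. x \<in> F \<Longrightarrow> dist (s x n) x < inverse (Suc n)"
      "\<And>x n. x \<in> F \<Longrightarrow> \<epsilon>/2 \<le> dist (f x) (f (s x n))"
    by metis
  obtain x0 where "x0 \<in> F" using F(2) by blast
  then obtain Q where Q: "countable Q" "x0 \<in> Q" "Q \<subseteq> F" "\<And>x n. x \<in> Q \<Longrightarrow> s x n \<in> Q"
    using ex_countable_closed_under[of x0 F s] s(1) by metis
  let ?out = "f -` (- closure (f ` Q))"
  let ?near = "\<lambda>q. f -` ball (f q) (\<epsilon>/4)"
  have cov: "closure Q \<subseteq> \<Union>(insert ?out (?near ` Q))"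
  proof
    fix x
    show "x \<in> \<Union>(insert ?out (?near ` Q))"
    proof (cases "f x \<in> closure (f ` Q)")
      case True
      then obtain q where "q \<in> Q" "dist (f q) (f x) < \<epsilon>/4"
        using \<open>\<epsilon> > 0\<close> unfolding closure_approachable by (metis (no_types) image_iff zero_less_divide_iff zero_less_numeral)
      then show ?thesis by auto
    qed auto
  qed
  have fs: "fsigma S" if "S \<in> insert ?out (?near ` Q)" for S
    using that f open_Compl[OF closed_closure] unfolding first_Lebesgue_class_def by blast
  have ne: "closure Q \<noteq> {}" using Q(2) by auto
  have "countable (insert ?out (?near ` Q))" using Q(1) by simp
  then obtain S W where S: "S \<in> insert ?out (?near ` Q)"
    and W: "open W" "W \<inter> closure Q \<noteq> {}" "W \<inter> closure Q \<subseteq> S"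
    by (rule hereditarily_Baire_fsigma_cover[OF hB closed_closure ne _ fs cov])
  obtain p where p: "p \<in> W" "p \<in> Q"
    using W(1,2) open_Int_closure_eq_empty by blast
  have WS: "x \<in> S" if "x \<in> W" "x \<in> Q" for x
    using W(3) that closure_subset by blast
  show False
  proof (cases "S = ?out")
    case True
    then show False
      using WS[OF p] p(2) closure_subset[of "f ` Q"] by auto
  next
    case False
    then obtain q where q: "S = ?near q" using S by blast
    \<comment> \<open>For large \<open>n\<close> the companion \<open>s p n\<close> also lies in
      \<open>W\<close>. Then both images are within \<open>\<epsilon>/4\<close> of
      \<open>f q\<close>, hence less than \<open>\<epsilon>/2\<close> apart, against the choice of
      \<open>s\<close>.\<close>
    obtain d where d: "d > 0" "ball p d \<subseteq> W"
      using W(1) p(1) open_contains_ball by blast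
    obtain n where "inverse (Suc n) < d" using reals_Archimedean[OF \<open>d > 0\<close>] by blast
    then have "s p n \<in> W"
      using d(2) s(2)[of p n] p(2) Q(3) by (force simp: dist_commute)
    then have "s p n \<in> S" "p \<in> S"
      using WS Q(4) p by auto
    then have "dist (f p) (f (s p n)) < \<epsilon>/2"
      using q dist_triangle_half_r[of "f q" "f p" "\<epsilon>/2" "f (s p n)"] by simp
    then show False using s(3)[of p n] p(2) Q(3) by force
  qed
qed

subsection \<open>Discrete families\<close>

text \<open>Near any point at most one \<open>C A\<close> is visible, so removing that closed set
  from the neighbourhood leaves an open set avoiding the whole union. The members \<open>A\<close>
  may be non-closed, which allows \<open>C A\<close> to be one closed layer of an F-sigma set
  \<open>A\<close>.\<close>

lemma closed_Union_discrete_family: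
  assumes disc: "discrete_family \<A>" and C: "\<And>A. A \<in> \<A> \<Longrightarrow> closed (C A)" "\<And>A. A \<in> \<A> \<Longrightarrow> C A \<subseteq> A"
  shows "closed (\<Union>A\<in>\<A>. C A)"
proof -
  have "\<exists>T. open T \<and> x \<in> T \<and> T \<subseteq> - (\<Union>A\<in>\<A>. C A)" if x: "x \<notin> (\<Union>A\<in>\<A>. C A)" for x
  proof -
    obtain U where U: "open U" "x \<in> U"
      "\<And>A B. A \<in> \<A> \<Longrightarrow> B \<in> \<A> \<Longrightarrow> A \<inter> U \<noteq> {} \<Longrightarrow> B \<inter> U \<noteq> {} \<Longrightarrow> A = B"
      using disc unfolding discrete_family_def by meson
    show ?thesis
    proof (cases "\<exists>A\<in>\<A>. A \<inter> U \<noteq> {}")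
      case True
      then obtain A where A: "A \<in> \<A>" "A \<inter> U \<noteq> {}" by blast
      have "U - C A \<subseteq> - (\<Union>A\<in>\<A>. C A)"
        using U(3)[OF A(1) _ A(2)] C(2) by fastforce
      then show ?thesis
        using U(1,2) C(1)[OF A(1)] A(1) x by (intro exI[of _ "U - C A"]) auto
    next
      case False
      then show ?thesis
        using U(1,2) C(2) by (intro exI[of _ U]) blast
    qed
  qed
  then have "\<exists>T. open T \<and> x \<in> T \<and> T \<subseteq> - (\<Union>A\<in>\<A>. C A)" if "x \<in> - (\<Union>A\<in>\<A>. C A)" for x
    using that by (simp only: Compl_iff)
  then have "open (- (\<Union>A\<in>\<A>. C A))"
    by (subst open_subopen) (rule ballI)
  then show ?thesis by (simp add: closed_def)
qed

text \<open>Write each member as a sequence of closed layers; the union of all \<open>n\<close>-th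
  layers is closed by discreteness.\<close>

lemma fsigma_Union_discrete_family:
  assumes disc: "discrete_family \<A>" and fs: "\<And>A. A \<in> \<A> \<Longrightarrow> fsigma A"
  shows "\<exists>C :: nat \<Rightarrow> _. (\<forall>n. closed (C n)) \<and> \<Union>\<A> = (\<Union>n. C n)"
proof -
  have "\<exists>C :: nat \<Rightarrow> 'a set. (\<forall>n. closed (C n)) \<and> A = (\<Union>n. C n)" if "A \<in> \<A>" for A
    using fs[OF that] by (cases rule: fsigma.cases) auto
  then obtain C :: "'a set \<Rightarrow> nat \<Rightarrow> 'a set"
    where C: "\<And>A n. A \<in> \<A> \<Longrightarrow> closed (C A n)" "\<And>A. A \<in> \<A> \<Longrightarrow> A = (\<Union>n. C A n)"
    by metis
  have "closed (\<Union>A\<in>\<A>. C A n)" for n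
    using closed_Union_discrete_family[OF disc, of "\<lambda>A. C A n"] C by blast
  moreover have "\<Union>\<A> = (\<Union>n. \<Union>A\<in>\<A>. C A n)"
  proof -
    have "\<Union>\<A> = (\<Union>A\<in>\<A>. \<Union>n. C A n)"
      using C(2) by (metis (no_types, lifting) SUP_cong image_ident)
    then show ?thesis by (metis SUP_commute)
  qed
  ultimately show ?thesis by (intro exI[of _ "\<lambda>n. \<Union>A\<in>\<A>. C A n"]) blast
qed

lemma fsigma_UN_nat:
  fixes A :: "nat \<Rightarrow> nat \<Rightarrow> 'a::topological_space set"
  assumes "\<And>m n. closed (A m n)"
  shows "fsigma (\<Union>m. \<Union>n. A m n)"
proof -
  have "(\<Union>m. \<Union>n. A m n) = (\<Union>k. (\<lambda>(m, n). A m n) (prod_decode k))"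
  proof (intro equalityI subsetI)
    fix x assume "x \<in> (\<Union>m. \<Union>n. A m n)"
    then obtain m n where "x \<in> A m n" by blast
    then show "x \<in> (\<Union>k. (\<lambda>(m, n). A m n) (prod_decode k))"
      by (intro UN_I[of "prod_encode (m, n)"]) auto
  qed (auto simp: split_beta)
  then show ?thesis
    using fsigma.intros[of "\<lambda>k. (\<lambda>(m, n). A m n) (prod_decode k)"] assms
    by (simp add: split_beta)
qed

lemma sigma_discrete_map_imp_first_Lebesgue_class:
  fixes f :: "'a::topological_space \<Rightarrow> 'b::topological_space"
  assumes "sigma_discrete_map_fsigma_base f"
  shows "first_Lebesgue_class f"
  unfolding first_Lebesgue_class_def
proof (intro allI impI)
  fix V :: "'b set" assume "open V"
  obtain \<B> \<A> where A: "\<And>n::nat. discrete_family (\<A> n)" "\<B> = (\<Union>n. \<A> n)"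
    and B: "base_for_map f \<B>" "\<And>B. B \<in> \<B> \<Longrightarrow> fsigma B"
    using assms unfolding sigma_discrete_map_fsigma_base_def sigma_discrete_family_def by metis
  obtain \<U> where U: "\<U> \<subseteq> \<B>" "f -` V = \<Union>\<U>"
    using B(1) \<open>open V\<close> unfolding base_for_map_def by meson
  \<comment> \<open>Subfamilies of discrete families are discrete, so the possibly uncountable union
    \<open>\<U>\<close> splits into countably many discrete ones.\<close>
  have "discrete_family (\<A> n \<inter> \<U>)" for n
    using A(1)[of n] unfolding discrete_family_def by (meson IntD1)
  then have "\<exists>C :: nat \<Rightarrow> _. (\<forall>k. closed (C k)) \<and> \<Union>(\<A> n \<inter> \<U>) = (\<Union>k. C k)" for n
    by (rule fsigma_Union_discrete_family) (use B(2) U(1) in blast)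
  then obtain C :: "nat \<Rightarrow> nat \<Rightarrow> _" where C: "\<And>n k. closed (C n k)"
      "\<And>n. \<Union>(\<A> n \<inter> \<U>) = (\<Union>k. C n k)"
    by metis
  have "\<U> = (\<Union>n. \<A> n \<inter> \<U>)"
    using U(1) A(2) by blast
  then have "\<Union>\<U> = (\<Union>n. \<Union>(\<A> n \<inter> \<U>))"
    by (rule arg_cong[where f = Union, THEN trans]) blast
  then have "f -` V = (\<Union>n. \<Union>(\<A> n \<inter> \<U>))"
    using U(2) by simp
  then show "fsigma (f -` V)"
    using fsigma_UN_nat[of C] C by simp
qed

subsection \<open>Decomposing the domain of a fragmented map\<close>

text \<open>Peel off pieces transfinitely along a well-order of \<open>'a set\<close>; since that type does not inject
  into \<open>'a\<close>, the pieces exhaust the space.\<close>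

lemma fragmented_imp_wf_open_cover:
  fixes f :: "'a::metric_space \<Rightarrow> 'b::metric_space"
  assumes "fragmented f \<epsilon>"
  obtains R :: "'a set rel" and H :: "'a set \<Rightarrow> 'a set"
  where "wf R" "\<And>i j. i \<noteq> j \<Longrightarrow> (i, j) \<in> R \<or> (j, i) \<in> R" "\<And>i. open (H i)" "(\<Union>i. H i) = UNIV"
    "\<And>i x y. x \<in> H i - (\<Union>j\<in>{j. (j, i) \<in> R}. H j) \<Longrightarrow> y \<in> H i - (\<Union>j\<in>{j. (j, i) \<in> R}. H j)
      \<Longrightarrow> dist (f x) (f y) < \<epsilon>"
proof -
  obtain r :: "'a set rel" where r: "Well_order r" "Field r = UNIV"
    using well_ordering[where 'a = "'a set"] by auto
  define R where "R = r - Id"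
  have wf: "wf R" using r unfolding R_def well_order_on_def by blast
  have total: "(i, j) \<in> R \<or> (j, i) \<in> R" if "i \<noteq> j" for i j
    using r that unfolding R_def order_on_defs total_on_def by auto
  \<comment> \<open>The guard on nonemptiness makes the condition satisfiable for empty
    \<open>F\<close> too, so one choice function \<open>g\<close> serves all closed sets.\<close>
  define small where "small F W \<longleftrightarrow> open W \<and> (F \<noteq> {} \<longrightarrow> W \<inter> F \<noteq> {}) \<and>
    (\<forall>x\<in>W \<inter> F. \<forall>y\<in>W \<inter> F. dist (f x) (f y) < \<epsilon>)" for F W
  have "\<exists>W. small F W" if "closed F" for F
  proof (cases "F = {}")
    case True
    then show ?thesis by (auto simp: small_def)
  next
    case False
    then show ?thesis using assms that unfolding fragmented_def small_def by simp
  qed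
  then obtain g where small_g: "\<And>F. closed F \<Longrightarrow> small F (g F)" by metis
  then have g: "\<And>F. closed F \<Longrightarrow> open (g F)" "\<And>F. closed F \<Longrightarrow> F \<noteq> {} \<Longrightarrow> g F \<inter> F \<noteq> {}"
    "\<And>F x y. closed F \<Longrightarrow> x \<in> g F \<inter> F \<Longrightarrow> y \<in> g F \<inter> F \<Longrightarrow> dist (f x) (f y) < \<epsilon>"
    unfolding small_def by blast+
  \<comment> \<open>\<open>F i\<close> is what remains before stage \<open>i\<close>, and
    \<open>H i\<close> is an open set cutting a small-oscillation piece from it.\<close>
  define H where "H = wfrec R (\<lambda>h i. g (- (\<Union>j\<in>{j. (j, i) \<in> R}. h j)))"
  define F where "F i = - (\<Union>j\<in>{j. (j, i) \<in> R}. H j)" for i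
  have H: "H i = g (F i)" for i
  proof -
    have "H i = g (- (\<Union>j\<in>{j. (j, i) \<in> R}. cut H R i j))"
      unfolding H_def by (rule wfrec[OF wf])
    also have "(\<Union>j\<in>{j. (j, i) \<in> R}. cut H R i j) = (\<Union>j\<in>{j. (j, i) \<in> R}. H j)"
      by (auto simp: cut_def)
    finally show ?thesis by (simp add: F_def)
  qed
  \<comment> \<open>Induction is needed because \<open>g\<close> is controlled only on closed sets:
    \<open>F i\<close> is closed once all earlier \<open>H j\<close> are open.\<close>
  have open_H: "open (H i)" for i
    using wf
  proof (induction i rule: wf_induct_rule)
    case (less i)
    then have "closed (F i)" unfolding F_def by (intro closed_Compl open_UN) auto
    then show ?case using g(1) H by simp
  qed
  have closed_F: "closed (F i)" for i
    unfolding F_def by (intro closed_Compl open_UN ballI open_H)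
  have "(\<Union>i. H i) = UNIV"
  proof (rule ccontr)
    assume "(\<Union>i. H i) \<noteq> UNIV"
    \<comment> \<open>If the peeling never ends, every stage contributes a new point, which injects
      \<open>'a set\<close> into \<open>'a\<close> and contradicts Cantor.\<close>
    then have ne: "F i \<noteq> {}" for i unfolding F_def by blast
    have "\<exists>x. x \<in> H i \<inter> F i" for i
      using g(2)[OF closed_F[of i] ne] H[of i] by auto
    then obtain x where x: "\<And>i. x i \<in> H i" "\<And>i. x i \<in> F i" by (metis Int_iff)
    have "x i \<noteq> x j" if "(j, i) \<in> R" for i j
      using x(1)[of j] x(2)[of i] that unfolding F_def by auto
    then have "inj x" using total by (metis injI)
    then have "range (inv x) = Pow UNIV" by (simp add: inj_imp_surj_inv)
    then show False using Cantors_theorem by metis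
  qed
  moreover have "H i - (\<Union>j\<in>{j. (j, i) \<in> R}. H j) = g (F i) \<inter> F i" for i
    by (subst H) (simp add: F_def Diff_eq)
  ultimately show thesis
    using that[of R H] wf total open_H g(3)[OF closed_F] by simp
qed

text \<open>\<open>P n i\<close> keeps the points of the \<open>i\<close>-th piece whose ball of
  radius \<open>1/(n+1)\<close> stays in \<open>H i\<close>. Points of later pieces lie outside
  \<open>H i\<close>, hence at least \<open>1/(n+1)\<close> away; comparability of the indices makes
  this symmetric.\<close>

lemma fragmented_imp_separated_pieces:
  fixes f :: "'a::metric_space \<Rightarrow> 'b::metric_space"
  assumes "fragmented f \<epsilon>"
  obtains P :: "nat \<Rightarrow> 'a set \<Rightarrow> 'a set"
  where "\<And>n i. closed (P n i)" "(\<Union>n i. P n i) = UNIV"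
    "\<And>m n i. m \<le> n \<Longrightarrow> P m i \<subseteq> P n i"
    "\<And>n i j x y. x \<in> P n i \<Longrightarrow> y \<in> P n j \<Longrightarrow> dist x y < inverse (Suc n) \<Longrightarrow> i = j"
    "\<And>n i x y. x \<in> P n i \<Longrightarrow> y \<in> P n i \<Longrightarrow> dist (f x) (f y) < \<epsilon>"
proof -
  obtain R :: "'a set rel" and H :: "'a set \<Rightarrow> 'a set"
  where wf: "wf R" and total: "\<And>i j. i \<noteq> j \<Longrightarrow> (i, j) \<in> R \<or> (j, i) \<in> R"
    and H: "\<And>i. open (H i)" "(\<Union>i. H i) = UNIV"
    and small: "\<And>i x y. x \<in> H i - (\<Union>j\<in>{j. (j, i) \<in> R}. H j) \<Longrightarrow>
      y \<in> H i - (\<Union>j\<in>{j. (j, i) \<in> R}. H j) \<Longrightarrow> dist (f x) (f y) < \<epsilon>"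
    using fragmented_imp_wf_open_cover[OF assms] by blast
  define P where "P n i = {x. ball x (inverse (Suc n)) \<subseteq> H i} - (\<Union>j\<in>{j. (j, i) \<in> R}. H j)"
    for n :: nat and i
  have sub: "P n i \<subseteq> H i - (\<Union>j\<in>{j. (j, i) \<in> R}. H j)" for n i
    unfolding P_def by (auto simp: subset_iff)
  have far: "inverse (Suc n) \<le> dist x y" if "x \<in> P n j" "y \<in> P n i" "(j, i) \<in> R" for n i j x y
  proof -
    have "y \<notin> H j" using that unfolding P_def by blast
    then have "y \<notin> ball x (inverse (Suc n))" using that(1) unfolding P_def by blast
    then show ?thesis by simp
  qed
  show thesis
  proof
    show "closed (P n i)" for n i
    proof -
      have "{x. ball x (inverse (Suc n)) \<subseteq> H i} = (\<Inter>y\<in>- H i. {x. inverse (Suc n) \<le> dist x y})"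
        by (force simp: subset_iff not_le)
      moreover have "closed {x. inverse (Suc n) \<le> dist x y}" for y :: 'a
        by (intro closed_Collect_le continuous_intros)
      ultimately have "closed {x. ball x (inverse (Suc n)) \<subseteq> H i}"
        by (simp add: closed_INT)
      then show ?thesis unfolding P_def using H(1) by (intro closed_Diff open_UN) auto
    qed
    show "(\<Union>n i. P n i) = UNIV"
    proof -
      have "\<exists>n i. x \<in> P n i" for x
      proof -
        \<comment> \<open>The piece containing \<open>x\<close> belongs to the least index whose
          open set contains \<open>x\<close>.\<close>
        obtain i where i: "x \<in> H i" "\<And>j. (j, i) \<in> R \<Longrightarrow> x \<notin> H j"
          using wfE_min[OF wf, of _ "{i. x \<in> H i}"] H(2) by (metis UNIV_I UN_iff mem_Collect_eq)
        obtain d where d: "d > 0" "ball x d \<subseteq> H i"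
          using H(1) i(1) open_contains_ball by blast
        obtain n where "inverse (Suc n) < d" using reals_Archimedean[OF \<open>d > 0\<close>] by blast
        then have "ball x (inverse (Suc n)) \<subseteq> H i" using d(2) by force
        then show ?thesis using i(2) unfolding P_def by blast
      qed
      then show ?thesis by auto
    qed
    show "P m i \<subseteq> P n i" if "m \<le> n" for m n i
    proof -
      have "inverse (real (Suc n)) \<le> inverse (real (Suc m))"
        using that by (simp add: field_simps)
      then have "ball x (inverse (Suc n)) \<subseteq> ball x (inverse (Suc m))" for x :: 'a
        by (rule subset_ball)
      then show ?thesis unfolding P_def by blast
    qed
    show "i = j" if "x \<in> P n i" "y \<in> P n j" "dist x y < inverse (Suc n)" for n i j x y
      using that far[of x n i y j] far[of y n j x i] total[of i j] by (auto simp: dist_commute)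
    show "dist (f x) (f y) < \<epsilon>" if "x \<in> P n i" "y \<in> P n i" for n i x y
      using small sub that by blast
  qed
qed

section \<open>A sigma-discrete base from separated pieces\<close>

lemma discrete_family_separated:
  fixes P :: "'i \<Rightarrow> 'a::metric_space set"
  assumes "r > 0" "\<And>i j x y. x \<in> P i \<Longrightarrow> y \<in> P j \<Longrightarrow> dist x y < r \<Longrightarrow> i = j"
  shows "discrete_family (range P)"
  unfolding discrete_family_def
proof (intro allI)
  fix z
  have "P i = P j" if "P i \<inter> ball z (r/2) \<noteq> {}" "P j \<inter> ball z (r/2) \<noteq> {}" for i j
  proof -
    obtain x y where "x \<in> P i" "dist z x < r/2" "y \<in> P j" "dist z y < r/2"
      using \<open>P i \<inter> ball z (r/2) \<noteq> {}\<close> \<open>P j \<inter> ball z (r/2) \<noteq> {}\<close> by auto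
    then show ?thesis using assms(2)[of x i y j] dist_triangle_half_r[of z x r y] by blast
  qed
  then show "\<exists>U. open U \<and> z \<in> U \<and>
      (\<forall>A\<in>range P. \<forall>B\<in>range P. A \<inter> U \<noteq> {} \<and> B \<inter> U \<noteq> {} \<longrightarrow> A = B)"
    using \<open>r > 0\<close> by (intro exI[of _ "ball z (r/2)"]) auto
qed

text \<open>The base collects the pieces for all scales \<open>1/(m+1)\<close> and all stages
  \<open>n\<close>. If the ball around \<open>f x\<close> of radius above \<open>1/(m+1)\<close>
  lies in \<open>V\<close>, any scale-\<open>m\<close> piece containing \<open>x\<close> lies in the
  preimage of \<open>V\<close>. The members are even closed.\<close>

lemma fragmented_imp_sigma_discrete_map:
  fixes f :: "'a::metric_space \<Rightarrow> 'b::metric_space"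
  assumes frag: "\<And>\<epsilon>. \<epsilon> > 0 \<Longrightarrow> fragmented f \<epsilon>"
  shows "sigma_discrete_map_fsigma_base f"
proof -
  have "\<exists>P :: nat \<Rightarrow> 'a set \<Rightarrow> 'a set. (\<forall>n i. closed (P n i)) \<and> (\<Union>n i. P n i) = UNIV \<and>
    (\<forall>n. discrete_family (range (P n))) \<and>
    (\<forall>n i. \<forall>x\<in>P n i. \<forall>y\<in>P n i. dist (f x) (f y) < inverse (Suc m))" for m :: nat
  proof -
    have "fragmented f (inverse (Suc m))" by (intro frag) simp
    from fragmented_imp_separated_pieces[OF this] obtain P :: "nat \<Rightarrow> 'a set \<Rightarrow> 'a set"
      where P: "\<And>n i. closed (P n i)" "(\<Union>n i. P n i) = UNIV" "\<And>m n i. m \<le> n \<Longrightarrow> P m i \<subseteq> P n i"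
        "\<And>n i j x y. x \<in> P n i \<Longrightarrow> y \<in> P n j \<Longrightarrow> dist x y < inverse (Suc n) \<Longrightarrow> i = j"
        "\<And>n i x y. x \<in> P n i \<Longrightarrow> y \<in> P n i \<Longrightarrow> dist (f x) (f y) < inverse (Suc m)"
      by blast
    have disc: "discrete_family (range (P n))" for n
      by (rule discrete_family_separated[of "inverse (Suc n)"]) (use P(4) in auto)
    show ?thesis
      by (intro exI[of _ P] conjI allI ballI P(1,2) disc) (rule P(5))
  qed
  then obtain P :: "nat \<Rightarrow> nat \<Rightarrow> 'a set \<Rightarrow> 'a set"
    where P: "\<And>m n i. closed (P m n i)" "\<And>m. (\<Union>n i. P m n i) = UNIV"
      "\<And>m n. discrete_family (range (P m n))"
      "\<And>m n i x y. x \<in> P m n i \<Longrightarrow> y \<in> P m n i \<Longrightarrow> dist (f x) (f y) < inverse (Suc m)"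
    by metis
  \<comment> \<open>Scale and stage are coded by one natural number, as a sigma-discrete family is
    indexed by a single sequence.\<close>
  define \<A> where "\<A> k = (case prod_decode k of (m, n) \<Rightarrow> range (P m n))" for k
  have in_A: "P m n i \<in> (\<Union>k. \<A> k)" for m n i
    by (rule UN_I[of "prod_encode (m, n)"]) (auto simp: \<A>_def)
  have "base_for_map f (\<Union>k. \<A> k)"
    unfolding base_for_map_def
  proof (intro allI impI)
    fix V :: "'b set" assume "open V"
    have "\<exists>m n i. x \<in> P m n i \<and> P m n i \<subseteq> f -` V" if "f x \<in> V" for x
    proof -
      obtain d where d: "d > 0" "ball (f x) d \<subseteq> V"
        using \<open>open V\<close> \<open>f x \<in> V\<close> open_contains_ball[of V] by blast
      obtain m where m: "inverse (Suc m) < d" using reals_Archimedean[OF \<open>d > 0\<close>] by blast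
      obtain n i where ni: "x \<in> P m n i" using P(2)[of m] by blast
      have "P m n i \<subseteq> f -` V"
        using P(4)[OF ni] m d(2) by (fastforce simp: subset_iff)
      then show ?thesis using ni by blast
    qed
    then have "f -` V = \<Union>{B \<in> (\<Union>k. \<A> k). B \<subseteq> f -` V}"
      using in_A by (auto; metis (no_types, lifting) subset_vimage_iff)
    then show "\<exists>\<U>\<subseteq>(\<Union>k. \<A> k). f -` V = \<Union>\<U>"
      by (intro exI[of _ "{B \<in> (\<Union>k. \<A> k). B \<subseteq> f -` V}"] conjI) auto
  qed
  moreover have "discrete_family (\<A> k)" for k
    unfolding \<A>_def by (cases "prod_decode k") (simp add: P(3))
  moreover have "fsigma B" if "B \<in> (\<Union>k. \<A> k)" for B
  proof -
    have "closed B" using that P(1) by (auto simp: \<A>_def split_beta)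
    then show ?thesis using fsigma.intros[of "\<lambda>_. B"] by simp
  qed
  ultimately show ?thesis
    unfolding sigma_discrete_map_fsigma_base_def sigma_discrete_family_def by blast
qed

subsection \<open>Baire-one gauges\<close>

text \<open>The approximants are the Lipschitz regularizations \<open>x \<mapsto> sup\<^sub>y (\<delta> y - n d(x, y))\<close>.\<close>

lemma upper_semicontinuous_imp_Baire_one_pos:
  fixes \<delta> :: "'a::metric_space \<Rightarrow> real"
  assumes pos: "\<And>x. \<delta> x > 0" and le1: "\<And>x. \<delta> x \<le> 1"
    and usc: "\<And>x e. e > 0 \<Longrightarrow> \<exists>r>0. \<forall>y. dist x y < r \<longrightarrow> \<delta> y < \<delta> x + e"
  shows "Baire_one_pos \<delta>"
proof -
  define g where "g n x = (SUP y. \<delta> y - real n * dist x y)" for n x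
  have bdd: "bdd_above (range (\<lambda>y. \<delta> y - real n * dist x y))" for n x
    by (intro bdd_aboveI[of _ 1]) (smt (verit) le1 image_iff mult_nonneg_nonneg of_nat_0_le_iff zero_le_dist)
  have upper: "\<delta> y - real n * dist x y \<le> g n x" for n x y
    unfolding g_def using bdd by (intro cSUP_upper) auto
  have ge: "\<delta> x \<le> g n x" for n x
    using upper[of x n x] by simp
  have lip: "g n x \<le> g n z + real n * dist x z" for n x z
    unfolding g_def[of n x]
  proof (rule cSUP_least)
    fix y
    have "real n * dist z y \<le> real n * (dist x z + dist x y)"
      by (intro mult_left_mono dist_triangle3) (auto simp: dist_commute)
    then show "\<delta> y - real n * dist x y \<le> g n z + real n * dist x z"
      using upper[of y n z] by (simp add: algebra_simps)
  qed simp
  have "continuous_on UNIV (g n)" for n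
  proof -
    have "dist (g n x) (g n z) \<le> real n * dist x z" for x z
      using lip[of n x z] lip[of n z x] by (auto simp: dist_real_def dist_commute abs_le_iff)
    then have "(real n)-lipschitz_on UNIV (g n)"
      by (intro lipschitz_onI) auto
    then show ?thesis by (rule lipschitz_on_continuous_on)
  qed
  moreover have "g n x > 0" for n x
    using pos[of x] ge[of x n] by linarith
  moreover have "(\<lambda>n. g n x) \<longlonglongrightarrow> \<delta> x" for x
  proof (rule LIMSEQ_I)
    fix e :: real assume "e > 0"
    then obtain r where r: "r > 0" "\<And>y. dist x y < r \<Longrightarrow> \<delta> y < \<delta> x + e/2"
      using usc[of "e/2" x] by auto
    \<comment> \<open>For \<open>n \<ge> N\<close> the penalty outside the \<open>r\<close>-ball is
      at least 1, which cancels \<open>\<delta> y \<le> 1\<close>; only points near \<open>x\<close>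
      matter, and there semicontinuity applies.\<close>
    obtain N where N: "inverse r < real N" using reals_Archimedean2 by blast
    have "norm (g n x - \<delta> x) < e" if "n \<ge> N" for n
    proof -
      have "g n x \<le> \<delta> x + e/2"
        unfolding g_def
      proof (rule cSUP_least)
        fix y
        show "\<delta> y - real n * dist x y \<le> \<delta> x + e/2"
        proof (cases "dist x y < r")
          case True
          have "0 \<le> real n * dist x y" by simp
          then show ?thesis using r(2)[OF True] by linarith
        next
          case False
          have "1 = inverse r * r" using r(1) by simp
          also have "\<dots> \<le> real n * dist x y"
            using False N that r(1) by (intro mult_mono) auto
          finally show ?thesis using le1[of y] pos[of x] \<open>e > 0\<close> by linarith
        qed
      qed simp
      then show ?thesis using ge[of x n] \<open>e > 0\<close> by simp
    qed
    then show "\<exists>no. \<forall>n\<ge>no. norm (g n x - \<delta> x) < e" by blast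
  qed
  ultimately show ?thesis
    unfolding Baire_one_pos_def using pos by blast
qed

text \<open>The gauge is \<open>1/(N x + 1)\<close>, with \<open>N x\<close> the first stage
  containing \<open>x\<close>. The stages \<open>C n\<close> are closed and increasing, so points
  near \<open>x\<close> cannot appear earlier than \<open>x\<close>; this is upper
  semicontinuity.\<close>

lemma fragmented_imp_Baire_one_gauge:
  fixes f :: "'a::metric_space \<Rightarrow> 'b::metric_space"
  assumes "fragmented f \<epsilon>"
  shows "\<exists>\<delta>. Baire_one_pos \<delta> \<and> gauge_condition f \<epsilon> \<delta>"
proof -
  obtain P :: "nat \<Rightarrow> 'a set \<Rightarrow> 'a set"
    where P: "\<And>n i. closed (P n i)" "(\<Union>n i. P n i) = UNIV" "\<And>m n i. m \<le> n \<Longrightarrow> P m i \<subseteq> P n i"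
      "\<And>n i j x y. x \<in> P n i \<Longrightarrow> y \<in> P n j \<Longrightarrow> dist x y < inverse (Suc n) \<Longrightarrow> i = j"
      "\<And>n i x y. x \<in> P n i \<Longrightarrow> y \<in> P n i \<Longrightarrow> dist (f x) (f y) < \<epsilon>"
    using fragmented_imp_separated_pieces[OF assms] by blast
  define C where "C n = (\<Union>i. P n i)" for n
  define N where "N x = (LEAST n. x \<in> C n)" for x
  define \<delta> where "\<delta> x = inverse (real (Suc (N x)))" for x
  have N: "x \<in> C (N x)" for x
  proof -
    have "x \<in> (\<Union>n i. P n i)" using P(2) by simp
    then have "\<exists>n. x \<in> C n" by (auto simp: C_def)
    then show ?thesis unfolding N_def by (rule LeastI_ex)
  qed
  have C_mono: "C m \<subseteq> C n" if "m \<le> n" for m n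
    using P(3)[OF that] unfolding C_def by blast
  have closed_C: "closed (C n)" for n
  proof -
    have "discrete_family (range (P n))"
      by (rule discrete_family_separated[of "inverse (Suc n)"]) (use P(4) in auto)
    then have "closed (\<Union>A\<in>range (P n). A)"
      by (rule closed_Union_discrete_family) (use P(1) in auto)
    then show ?thesis by (simp add: C_def)
  qed
  have "Baire_one_pos \<delta>"
  proof (rule upper_semicontinuous_imp_Baire_one_pos)
    show "\<delta> x > 0" for x by (simp add: \<delta>_def)
    show "\<delta> x \<le> 1" for x by (simp add: \<delta>_def field_simps)
    fix x and e :: real assume "e > 0"
    show "\<exists>r>0. \<forall>y. dist x y < r \<longrightarrow> \<delta> y < \<delta> x + e"
    proof (cases "N x")
      case 0
      have "\<delta> y \<le> \<delta> x" for y by (simp add: \<delta>_def 0 field_simps)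
      then have "\<delta> y < \<delta> x + e" for y using \<open>e > 0\<close> by (smt (verit))
      then show ?thesis by (intro exI[of _ 1]) auto
    next
      case (Suc k)
      then have "x \<notin> C k" unfolding N_def by (metis lessI not_less_Least)
      then obtain r where r: "r > 0" "ball x r \<subseteq> - C k"
        using open_Compl[OF closed_C] open_contains_ball[of "- C k"] by blast
      have "\<delta> y < \<delta> x + e" if "dist x y < r" for y
      proof -
        have "y \<notin> C k" using r(2) that by auto
        then have "\<not> N y \<le> k" using N[of y] C_mono by blast
        then have "\<delta> y \<le> \<delta> x" by (simp add: \<delta>_def Suc field_simps)
        then show ?thesis using \<open>e > 0\<close> by linarith
      qed
      then show ?thesis using r(1) by blast
    qed
  qed
  moreover have "gauge_condition f \<epsilon> \<delta>"
    unfolding gauge_condition_def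
  proof (intro allI impI)
    fix x y assume d: "dist x y < min (\<delta> x) (\<delta> y)"
    \<comment> \<open>The larger stage contains both points, and its separation
      \<open>1/(n+1)\<close> is exactly the smaller of the two gauges.\<close>
    define n where "n = max (N x) (N y)"
    have "x \<in> C n" "y \<in> C n"
      using N[of x] N[of y] C_mono[of "N x" n] C_mono[of "N y" n] by (auto simp: n_def)
    then obtain i j where ij: "x \<in> P n i" "y \<in> P n j" by (auto simp: C_def)
    have "dist x y < inverse (Suc n)" using d by (auto simp: \<delta>_def n_def max_def)
    then have "i = j" using P(4) ij by blast
    then show "dist (f x) (f y) < \<epsilon>" using P(5) ij by blast
  qed
  ultimately show ?thesis by blast
qed

theorem theorem3:
  fixes f :: "'a::metric_space \<Rightarrow> 'b::metric_space"
  assumes "hereditarily_Baire (euclidean :: 'a topology)"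
  shows "(sigma_discrete_map_fsigma_base f \<longleftrightarrow> first_Lebesgue_class f) \<and>
    (first_Lebesgue_class f \<longleftrightarrow> barely_continuous f) \<and>
    (barely_continuous f \<longleftrightarrow>
      (\<forall>\<epsilon>>0. \<exists>\<delta>. Baire_one_pos \<delta> \<and> gauge_condition f \<epsilon> \<delta>)) \<and>
    ((\<forall>\<epsilon>>0. \<exists>\<delta>. Baire_one_pos \<delta> \<and> gauge_condition f \<epsilon> \<delta>) \<longleftrightarrow>
      (\<forall>\<epsilon>>0. \<exists>\<delta>. (\<forall>x. \<delta> x > 0) \<and> gauge_condition f \<epsilon> \<delta>))"
proof -
  \<comment> \<open>Fragmentation is the hub: it closes the cycle through (1) and (2), is equivalent
    to (3), and closes the cycle through (4) and (5).\<close>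
  let ?frag = "\<forall>\<epsilon>>0. fragmented f \<epsilon>"
  have "?frag \<longrightarrow> sigma_discrete_map_fsigma_base f"
    using fragmented_imp_sigma_discrete_map by blast
  moreover have "sigma_discrete_map_fsigma_base f \<longrightarrow> first_Lebesgue_class f"
    using sigma_discrete_map_imp_first_Lebesgue_class by blast
  moreover have "first_Lebesgue_class f \<longrightarrow> ?frag"
    using first_Lebesgue_class_imp_fragmented assms by blast
  moreover have "barely_continuous f \<longleftrightarrow> ?frag"
    using barely_continuous_imp_fragmented fragmented_imp_barely_continuous assms by blast
  moreover have "?frag \<longrightarrow> (\<forall>\<epsilon>>0. \<exists>\<delta>. Baire_one_pos \<delta> \<and> gauge_condition f \<epsilon> \<delta>)"
    using fragmented_imp_Baire_one_gauge by blast
  moreover have "(\<forall>\<epsilon>>0. \<exists>\<delta>. Baire_one_pos \<delta> \<and> gauge_condition f \<epsilon> \<delta>) \<longrightarrow>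
      (\<forall>\<epsilon>>0. \<exists>\<delta>. (\<forall>x. \<delta> x > 0) \<and> gauge_condition f \<epsilon> \<delta>)"
    unfolding Baire_one_pos_def by blast
  moreover have "(\<forall>\<epsilon>>0. \<exists>\<delta>. (\<forall>x. \<delta> x > 0) \<and> gauge_condition f \<epsilon> \<delta>) \<longrightarrow> ?frag"
  proof (intro impI allI)
    fix \<epsilon> :: real
    assume all: "\<forall>\<epsilon>>0. \<exists>\<delta>. (\<forall>x. \<delta> x > 0) \<and> gauge_condition f \<epsilon> \<delta>" and "\<epsilon> > 0"
    then obtain \<delta> where "\<And>x. \<delta> x > 0" "gauge_condition f (\<epsilon>/3) \<delta>"
      by (meson zero_less_divide_iff zero_less_numeral)
    then show "fragmented f \<epsilon>"
      using gauge_condition_imp_fragmented[OF assms] by blast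
  qed
  ultimately show ?thesis by argo
qed

end
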